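(* Let $m\ge 2$, $n\ge 1$ and suppose that $\mathcal{A}=(a_{i_1\cdots i_m})\in T_{m,n}$ is a doubly $B$-tensor. Then every principal sub-tensor of $\mathcal{A}$ is also a doubly $B$-tensor.
   Context: $[n]=\{1,\dots,n\}$. $T_{m,n}$ is the set of real $m$th order $n$-dimensional tensors $\mathcal{A}=(a_{i_1\cdots i_m})$, $i_1,\dots,i_m\in[n]$. For $\mathcal{A}\in T_{m,n}$ and $i\in[n]$ let $r_i^+=\max\{0,\,a_{ij_2\cdots j_m}:(j_2,\dots,j_m)\ne(i,\dots,i)\}$. $\mathcal{A}$ is a doubly $B$-tensor if (1) $a_{i\cdots i}>r_i^+$ for all $i\in[n]$, and (2) for all $i\ne j$ in $[n]$, $$(a_{i\cdots i}-r_i^+)(a_{j\cdots j}-r_j^+)>\sum_{(i_2,\dots,i_m)\ne(i,\dots,i)}(r_i^+-a_{ii_2\cdots i_m})\sum_{(j_2,\dots,j_m)\ne(j,\dots,j)}(r_j^+-a_{jj_2\cdots j_m}).$$ For a nonempty subset $J\subseteq[n]$ with $|J|=r$, the principal sub-tensor of $\mathcal{A}$ indexed by $J$ is the $m$th order $r$-dimensional tensor $(a_{i_1\cdots i_m})_{i_1,\dots,i_m\in J}$; the doubly $B$-tensor property for it is the one above with index set $J$ in place of $[n]$ (so its maxima $r_i^+$ and sums range over indices in $J$). *)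

theory Defs
  imports Complex_Main "HOL-Library.FuncSet"
begin

text \<open>
  The index set is an arbitrary finite set \<open>I\<close> of natural numbers rather than only \<open>{1..n}\<close>,
  so that a principal sub-tensor keeps its original index set \<open>J\<close>. The entry
  $a_{i_1 \cdots i_m}$ is the value at the list \<open>[i\<^sub>1, \<dots>, i\<^sub>m]\<close>.
\<close>

definition multi_indices :: "nat \<Rightarrow> nat set \<Rightarrow> nat list set" where
  "multi_indices k I = {js. length js = k \<and> set js \<subseteq> I}"

text \<open>Tensors are extensional (\<open>undefined\<close> off the multi-indices), so \<open>T\<^bsub>m,n\<^esub>\<close>
  is \<open>tensors m {1..n}\<close>.\<close>

definition tensors :: "nat \<Rightarrow> nat set \<Rightarrow> (nat list \<Rightarrow> real) set" where
  "tensors m I = multi_indices m I \<rightarrow>\<^sub>E UNIV"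

text \<open>The tuples \<open>(j\<^sub>2, \<dots>, j\<^sub>m) \<noteq> (i, \<dots>, i)\<close>.\<close>

definition off_diag :: "nat \<Rightarrow> nat set \<Rightarrow> nat \<Rightarrow> nat list set" where
  "off_diag m I i = multi_indices (m - 1) I - {replicate (m - 1) i}"

definition r_plus :: "nat \<Rightarrow> nat set \<Rightarrow> (nat list \<Rightarrow> real) \<Rightarrow> nat \<Rightarrow> real" where
  "r_plus m I A i = Max (insert 0 ((\<lambda>js. A (i # js)) ` off_diag m I i))"

definition doubly_B_tensor :: "nat \<Rightarrow> nat set \<Rightarrow> (nat list \<Rightarrow> real) \<Rightarrow> bool" where
  "doubly_B_tensor m I A \<longleftrightarrow>
     (\<forall>i\<in>I. A (replicate m i) > r_plus m I A i) \<and>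
     (\<forall>i\<in>I. \<forall>j\<in>I. i \<noteq> j \<longrightarrow>
        (A (replicate m i) - r_plus m I A i) * (A (replicate m j) - r_plus m I A j)
        > (\<Sum>is\<in>off_diag m I i. r_plus m I A i - A (i # is)) *
          (\<Sum>js\<in>off_diag m I j. r_plus m I A j - A (j # js)))"

definition principal_subtensor :: "nat \<Rightarrow> nat set \<Rightarrow> (nat list \<Rightarrow> real) \<Rightarrow> nat list \<Rightarrow> real" where
  "principal_subtensor m J A = restrict A (multi_indices m J)"

lemma finite_multi_indices: "finite I \<Longrightarrow> finite (multi_indices k I)"
  using finite_lists_length_eq[of I k] by (simp add: multi_indices_def conj_commute)

lemma finite_off_diag: "finite I \<Longrightarrow> finite (off_diag m I i)"
  by (simp add: off_diag_def finite_multi_indices)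

lemma principal_subtensor_in_tensors: "principal_subtensor m J A \<in> tensors m J"
  by (simp add: principal_subtensor_def tensors_def)

end

theory Submission
  imports Defs
begin

text \<open>
  Shrinking the index set can only lower each \<open>r_plus\<close>. So the diagonal gaps do not decrease,
  while the row sums, whose terms are nonnegative, lose terms and do not increase; both sides of
  the product inequality therefore move in the favourable direction.
\<close>

lemma off_diag_mono: "J \<subseteq> I \<Longrightarrow> off_diag m J i \<subseteq> off_diag m I i"
  by (auto simp: off_diag_def multi_indices_def)

lemma entry_le_r_plus:
  assumes "finite I" and "js \<in> off_diag m I i"
  shows "A (i # js) \<le> r_plus m I A i"
  unfolding r_plus_def using assms by (intro Max_ge) (auto simp: finite_off_diag)

text \<open>The inserted 0 keeps the smaller set nonempty, as \<open>Max_mono\<close> demands, even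
  when \<open>J\<close> is a singleton and its row has no off-diagonal entry.\<close>

lemma r_plus_mono:
  assumes "finite I" and "J \<subseteq> I"
  shows "r_plus m J A i \<le> r_plus m I A i"
  unfolding r_plus_def using assms off_diag_mono[OF assms(2), of m i]
  by (intro Max_mono) (auto simp: finite_off_diag)

lemma row_sum_nonneg:
  assumes "finite I"
  shows "0 \<le> (\<Sum>js\<in>off_diag m I i. r_plus m I A i - A (i # js))"
  using entry_le_r_plus[OF assms] by (intro sum_nonneg) simp

lemma row_sum_mono:
  assumes "finite I" and "J \<subseteq> I"
  shows "(\<Sum>js\<in>off_diag m J i. r_plus m J A i - A (i # js))
       \<le> (\<Sum>js\<in>off_diag m I i. r_plus m I A i - A (i # js))"
proof -
  \<comment> \<open>The intermediate sum separates the two effects: first only the maximum grows,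
    then only the range of summation, where each added term is nonnegative by
    \<open>entry_le_r_plus\<close>.\<close>
  have "(\<Sum>js\<in>off_diag m J i. r_plus m J A i - A (i # js))
      \<le> (\<Sum>js\<in>off_diag m J i. r_plus m I A i - A (i # js))"
    using r_plus_mono[OF assms] by (intro sum_mono) simp
  also have "\<dots> \<le> (\<Sum>js\<in>off_diag m I i. r_plus m I A i - A (i # js))"
    using assms entry_le_r_plus[OF assms(1)]
    by (intro sum_mono2) (auto simp: finite_off_diag dest: subsetD[OF off_diag_mono])
  finally show ?thesis .
qed

text \<open>Only the index set changes here, while \<open>A\<close> stays the same function;
  restricting \<open>A\<close> itself is dealt with separately.\<close>

lemma doubly_B_tensor_subset:
  assumes "finite I" and "J \<subseteq> I" and B: "doubly_B_tensor m I A"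
  shows "doubly_B_tensor m J A"
proof -
  let ?g = "\<lambda>K i. A (replicate m i) - r_plus m K A i"
  let ?s = "\<lambda>K i. \<Sum>js\<in>off_diag m K i. r_plus m K A i - A (i # js)"
  have pos: "0 < ?g I i" if "i \<in> J" for i
    using B that assms(2) by (auto simp: doubly_B_tensor_def)
  have gap: "?g I i \<le> ?g J i" for i
    using r_plus_mono[OF assms(1,2), of m A i] by simp
  have "?s J i * ?s J j < ?g J i * ?g J j" if "i \<in> J" "j \<in> J" "i \<noteq> j" for i j
  proof -
    have "?s J i * ?s J j \<le> ?s I i * ?s I j"
      \<comment> \<open>\<open>mult_mono\<close> asks for one nonnegative row sum over
        \<open>I\<close> and one over \<open>J\<close>, so finiteness of \<open>J\<close> enters as
        well.\<close>
      using assms(1,2) finite_subset[OF assms(2,1)]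
      by (intro mult_mono row_sum_mono row_sum_nonneg)
    also have "\<dots> < ?g I i * ?g I j"
      using B that assms(2) unfolding doubly_B_tensor_def by blast
    also have "\<dots> \<le> ?g J i * ?g J j"
      using pos[OF that(1)] pos[OF that(2)] gap[of i] gap[of j] by (intro mult_mono) linarith+
    finally show ?thesis .
  qed
  moreover have "r_plus m J A i < A (replicate m i)" if "i \<in> J" for i
    using pos[OF that] gap[of i] by linarith
  ultimately show ?thesis
    unfolding doubly_B_tensor_def by blast
qed

text \<open>The property reads a tensor only at lists of length \<open>m\<close> over
  \<open>J\<close>, and there the restriction agrees with \<open>A\<close>.\<close>

lemma doubly_B_tensor_principal_subtensor:
  assumes "1 \<le> m"
  shows "doubly_B_tensor m J (principal_subtensor m J A) \<longleftrightarrow> doubly_B_tensor m J A"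
proof -
  let ?P = "principal_subtensor m J A"
  have row: "?P (i # js) = A (i # js)" if "i \<in> J" "js \<in> off_diag m J i" for i js
    using that assms by (auto simp: principal_subtensor_def off_diag_def multi_indices_def)
  have diag: "?P (replicate m i) = A (replicate m i)" if "i \<in> J" for i
    using that by (auto simp: principal_subtensor_def multi_indices_def)
  have r: "r_plus m J ?P i = r_plus m J A i" if "i \<in> J" for i
    using row[OF that] by (simp add: r_plus_def cong: image_cong)
  have s: "(\<Sum>js\<in>off_diag m J i. r_plus m J A i - ?P (i # js))
         = (\<Sum>js\<in>off_diag m J i. r_plus m J A i - A (i # js))" if "i \<in> J" for i
    using row[OF that] by simp
  show ?thesis
    \<comment> \<open>The rewrite \<open>r\<close> acts first, which is why the left side of
      \<open>s\<close> already carries the maximum of \<open>A\<close>.\<close>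
    unfolding doubly_B_tensor_def by (simp add: diag r s cong: ball_cong)
qed

theorem theorem2:
  fixes m n :: nat and A :: "nat list \<Rightarrow> real"
  assumes "m \<ge> 2" and "n \<ge> 1"
    and "A \<in> tensors m {1..n}"
    and "doubly_B_tensor m {1..n} A"
  shows "\<forall>J. J \<noteq> {} \<and> J \<subseteq> {1..n} \<longrightarrow> doubly_B_tensor m J (principal_subtensor m J A)"
  \<comment> \<open>The index set shrinks from \<open>{1..n}\<close> to \<open>J\<close> with
    \<open>A\<close> fixed; then \<open>A\<close> is exchanged for its restriction.\<close>
  using assms doubly_B_tensor_subset[of "{1..n}"]
  by (simp add: doubly_B_tensor_principal_subtensor)

end
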